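(* Let $K$ be a finite field, let $S=K[t_1,\ldots,t_s]$, let $X=\{P_1,\ldots,P_m\}$ be a subset of $K^s$ with $|X|=m\ge 2$, let $I=I(X)$ be its vanishing ideal, and let $\prec$ be a graded monomial order on $S$. Let $\mathfrak{p}_i$ be the vanishing ideal of $P_i$. The following hold. (a) For each $1\leq i\leq m$ there is a unique $f_i\in K\Delta_\prec(I)$ such that $f_i(P_i)=1$ and $f_i(P_j)=0$ if $j\neq i$. The degree of $f_i$ is $\mathrm{v}_{\mathfrak{p}_i}(I)$, and the set $F=\{f_1,\ldots,f_m\}$ is a $K$-basis for $K\Delta_\prec(I)$. (b) $\ker(\varphi)=K\{f_i-f_m\}_{i=1}^{m-1}+I$. (c) $K\{f_i-f_m\}_{i=1}^{m-1}=\ker(\varphi)\cap K\Delta_\prec(I)=K^\perp$. (d) If $r_0=\mathrm{reg}(H_I^a)$, then $\deg(f_i)\leq r_0$ for all $i$ and $\deg(f_j)=r_0$ for some $j$.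
   Context: $I(X)$ is the ideal of all polynomials vanishing on $X$. A graded monomial order compares monomials first by total degree. $\Delta_\prec(I)$ is the set of standard monomials of $S/I$ (monomials not in $\mathrm{in}_\prec(I)$). $K\mathcal{M}$ denotes the $K$-span in $S$ of a set $\mathcal{M}\subset S$. $\varphi\colon S\to K$ is the $K$-linear map $\varphi(f)=f(P_1)+\cdots+f(P_m)$. For a finite-dimensional linear subspace $\mathcal{L}\subset S$, the algebraic dual is $\mathcal{L}^\perp=\{g\in K\Delta_\prec(I): g\mathcal{L}\subset\ker(\varphi)\}$; $K^\perp$ is the algebraic dual of the subspace $\mathcal{L}=K\subset S$ of constant polynomials. $\mathrm{v}_{\mathfrak{p}_i}(I)=\min\{d\ge 0: \exists\, 0\ne f\in S,\ \deg(f)=d,\ (I\colon f)=\mathfrak{p}_i\}$, where $(I\colon f)=\{g\in S: gf\in I\}$. With $S_{\le d}$ the polynomials of total degree at most $d$ and $I_{\le d}=I\cap S_{\le d}$, $H_I^a(d)=\dim_K(S_{\le d}/I_{\le d})$, and $\mathrm{reg}(H_I^a)$ is the least integer $\ell\ge 0$ with $H_I^a(d)=|X|$ for all $d\ge\ell$. *)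

theory Defs
  imports Complex_Main "HOL-Library.Poly_Mapping"
begin

text \<open>Exponent vectors are finitely supported maps on the finite type of variables, so
  \<open>('v, 'k) mpoly\<close> with multiplication inherited from \<^theory>\<open>HOL-Library.Poly_Mapping\<close> is the
  polynomial ring over \<open>'k\<close> in \<open>CARD('v)\<close> variables; points of affine space are functions
  \<open>'v \<Rightarrow> 'k\<close>.\<close>

type_synonym 'v monom = "'v \<Rightarrow>\<^sub>0 nat"
type_synonym ('v, 'k) mpoly = "'v monom \<Rightarrow>\<^sub>0 'k"

definition const :: "'k::zero \<Rightarrow> ('v, 'k) mpoly" where
  "const c = Poly_Mapping.single 0 c"

definition eval :: "('v::finite, 'k::comm_semiring_1) mpoly \<Rightarrow> ('v \<Rightarrow> 'k) \<Rightarrow> 'k" where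
  "eval f x = (\<Sum>a\<in>Poly_Mapping.keys f.
     Poly_Mapping.lookup f a * (\<Prod>v\<in>UNIV. x v ^ Poly_Mapping.lookup a v))"

definition monom_deg :: "'v::finite monom \<Rightarrow> nat" where
  "monom_deg a = (\<Sum>v\<in>UNIV. Poly_Mapping.lookup a v)"

text \<open>The zero polynomial gets total degree \<open>0\<close>.\<close>

definition total_deg :: "('v::finite, 'k::zero) mpoly \<Rightarrow> nat" where
  "total_deg f = Max (insert 0 (monom_deg ` Poly_Mapping.keys f))"

definition scale :: "'k::comm_semiring_1 \<Rightarrow> ('v, 'k) mpoly \<Rightarrow> ('v, 'k) mpoly" where
  "scale c f = const c * f"

global_interpretation mpoly: vector_space
  "scale :: 'k::field \<Rightarrow> ('v, 'k) mpoly \<Rightarrow> ('v, 'k) mpoly"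
  by unfold_locales
    (simp_all add: scale_def const_def distrib_left distrib_right single_add
      mult.assoc [symmetric] mult_single)

text \<open>The ideal generated by a set is its span in the ring viewed as a module over itself.\<close>

definition ideal_gen :: "'a::comm_ring_1 set \<Rightarrow> 'a set" where
  "ideal_gen A = module.span (*) A"

definition colon :: "'a::comm_ring_1 set \<Rightarrow> 'a \<Rightarrow> 'a set" where
  "colon I f = {g. g * f \<in> I}"

definition vanishing_ideal :: "('v::finite \<Rightarrow> 'k::field) set \<Rightarrow> ('v, 'k) mpoly set" where
  "vanishing_ideal X = {f. \<forall>x\<in>X. eval f x = 0}"

text \<open>Orders on monomials are given as reflexive relations on exponent vectors:
  \<open>(a, b) \<in> r\<close> means that \<open>a\<close> is at most \<open>b\<close>.\<close>

definition monomial_order :: "'v monom rel \<Rightarrow> bool" where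
  "monomial_order r \<longleftrightarrow> well_order r \<and> (\<forall>a b c. (a, b) \<in> r \<longrightarrow> (a + c, b + c) \<in> r)"

definition graded_monomial_order :: "'v::finite monom rel \<Rightarrow> bool" where
  "graded_monomial_order r \<longleftrightarrow>
     monomial_order r \<and> (\<forall>a b. monom_deg a < monom_deg b \<longrightarrow> (a, b) \<in> r)"

definition lead_monom :: "'v monom rel \<Rightarrow> ('v, 'k::zero) mpoly \<Rightarrow> 'v monom" where
  "lead_monom r f =
     (THE a. a \<in> Poly_Mapping.keys f \<and> (\<forall>b\<in>Poly_Mapping.keys f. (b, a) \<in> r))"

definition initial_ideal ::
    "'v monom rel \<Rightarrow> ('v, 'k::field) mpoly set \<Rightarrow> ('v, 'k) mpoly set" where
  "initial_ideal r I =
     ideal_gen {Poly_Mapping.single (lead_monom r f) 1 | f. f \<in> I \<and> f \<noteq> 0}"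

definition std_monomials ::
    "'v monom rel \<Rightarrow> ('v, 'k::field) mpoly set \<Rightarrow> ('v, 'k) mpoly set" where
  "std_monomials r I =
     {Poly_Mapping.single a 1 | a. Poly_Mapping.single a 1 \<notin> initial_ideal r I}"

definition std_span ::
    "'v monom rel \<Rightarrow> ('v, 'k::field) mpoly set \<Rightarrow> ('v, 'k) mpoly set" where
  "std_span r I = mpoly.span (std_monomials r I)"

definition v_number ::
    "('v::finite, 'k::field) mpoly set \<Rightarrow> ('v, 'k) mpoly set \<Rightarrow> nat" where
  "v_number I p = (LEAST d. \<exists>f. f \<noteq> 0 \<and> total_deg f = d \<and> colon I f = p)"

text \<open>\<open>quot_basis U W B\<close>: the residue classes of the elements of \<open>B\<close> are pairwise distinct and
  form a basis of the quotient space \<open>U / W\<close>, for a finite set \<open>B\<close>.\<close>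

definition quot_basis ::
    "('v, 'k::field) mpoly set \<Rightarrow> ('v, 'k) mpoly set \<Rightarrow> ('v, 'k) mpoly set \<Rightarrow> bool" where
  "quot_basis U W B \<longleftrightarrow> finite B \<and> B \<subseteq> U \<and>
     (\<forall>c. (\<Sum>b\<in>B. scale (c b) b) \<in> W \<longrightarrow> (\<forall>b\<in>B. c b = 0)) \<and>
     (\<forall>u\<in>U. \<exists>c. u - (\<Sum>b\<in>B. scale (c b) b) \<in> W)"

definition quot_dim :: "('v, 'k::field) mpoly set \<Rightarrow> ('v, 'k) mpoly set \<Rightarrow> nat" where
  "quot_dim U W = (THE n. \<exists>B. quot_basis U W B \<and> card B = n)"

definition deg_le :: "nat \<Rightarrow> ('v::finite, 'k::zero) mpoly set" where
  "deg_le d = {f. total_deg f \<le> d}"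

definition affine_hilbert :: "('v::finite, 'k::field) mpoly set \<Rightarrow> nat \<Rightarrow> nat" where
  "affine_hilbert I d = quot_dim (deg_le d) (I \<inter> deg_le d)"

definition hilbert_reg :: "('v::finite \<Rightarrow> 'k::field) set \<Rightarrow> nat" where
  "hilbert_reg X =
     (LEAST l. \<forall>d\<ge>l. affine_hilbert (vanishing_ideal X) d = card X)"

definition phi :: "('v::finite \<Rightarrow> 'k::field) set \<Rightarrow> ('v, 'k) mpoly \<Rightarrow> 'k" where
  "phi X f = (\<Sum>x\<in>X. eval f x)"

definition ker_phi :: "('v::finite \<Rightarrow> 'k::field) set \<Rightarrow> ('v, 'k) mpoly set" where
  "ker_phi X = {f. phi X f = 0}"

definition alg_dual ::
    "'v::finite monom rel \<Rightarrow> ('v \<Rightarrow> 'k::field) set \<Rightarrow> ('v, 'k) mpoly set \<Rightarrow> ('v, 'k) mpoly set"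
  where "alg_dual r X L =
     {g \<in> std_span r (vanishing_ideal X). \<forall>h\<in>L. g * h \<in> ker_phi X}"

end

theory Submission
  imports Defs
begin

text \<open>The span \<open>K\<Delta>\<close> of the standard monomials is a complement of the vanishing ideal \<open>I\<close> in the
  polynomial ring: it meets \<open>I\<close> only in \<open>0\<close> (\<open>std_span_Int_ideal\<close>), and every polynomial can be
  reduced modulo \<open>I\<close> to an element of \<open>K\<Delta>\<close> without raising its degree (\<open>reduce_to_std_span\<close>);
  the degree bound is where gradedness of the order enters. Evaluation at the points therefore
  identifies \<open>K\<Delta>\<close> with the space of all functions on \<open>X\<close>, as separating polynomials exist for
  finitely many points. The \<open>f\<^sub>i\<close> are the elements that correspond to the indicator functions of the
  points; they are a basis, and the normal form of any \<open>g\<close> is its interpolant \<open>\<Sum> g(P\<^sub>i) f\<^sub>i\<close>.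

  Everything is read off from this projection. A polynomial \<open>h\<close> satisfies \<open>(I : h) = \<pp>\<^sub>i\<close> iff \<open>P\<^sub>i\<close> is
  the only point at which \<open>h\<close> does not vanish, that is, iff its normal form is a nonzero multiple
  of \<open>f\<^sub>i\<close>; as taking normal forms does not raise degrees, \<open>f\<^sub>i\<close> has the least degree among these \<open>h\<close>.
  The map \<open>\<phi>\<close> sums the coordinates with respect to the basis \<open>f\<^sub>1, \<dots>, f\<^sub>m\<close> and is zero on \<open>I\<close>, so
  its kernel is spanned by the differences \<open>f\<^sub>i - f\<^sub>m\<close> modulo \<open>I\<close>. Finally
  \<open>S\<^sub>\<le>\<^sub>d / I\<^sub>\<le>\<^sub>d\<close> is isomorphic to the part of \<open>K\<Delta>\<close> in degrees at most \<open>d\<close>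
  (\<open>quot_dim_kernel\<close>), which has dimension \<open>m\<close> iff it contains every \<open>f\<^sub>i\<close>; so the regularity is the
  largest of the degrees of the \<open>f\<^sub>i\<close>.\<close>

section \<open>Evaluation\<close>

lemma eval_eq_sum:
  assumes "finite A" "Poly_Mapping.keys f \<subseteq> A"
  shows "eval f x = (\<Sum>a\<in>A. Poly_Mapping.lookup f a * (\<Prod>v\<in>UNIV. x v ^ Poly_Mapping.lookup a v))"
  unfolding eval_def
  by (rule sum.mono_neutral_left) (use assms in \<open>auto simp: in_keys_iff\<close>)

lemma eval_zero [simp]: "eval 0 x = 0"
  by (simp add: eval_def)

lemma eval_add [simp]: "eval (f + g) x = eval f x + eval g x"
proof -
  let ?A = "Poly_Mapping.keys f \<union> Poly_Mapping.keys g"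
  have "finite ?A" "Poly_Mapping.keys (f + g) \<subseteq> ?A"
    by (auto simp: Poly_Mapping.keys_add)
  then show ?thesis
    by (simp add: eval_eq_sum[of ?A] lookup_add distrib_right sum.distrib)
qed

lemma eval_sum [simp]: "eval (\<Sum>i\<in>A. f i) x = (\<Sum>i\<in>A. eval (f i) x)"
  by (induction A rule: infinite_finite_induct) auto

lemma eval_single:
  "eval (Poly_Mapping.single a c) x = c * (\<Prod>v\<in>UNIV. x v ^ Poly_Mapping.lookup a v)"
  by (subst eval_eq_sum[of "{a}"]) auto

lemma eval_const [simp]: "eval (const c) x = c"
  by (simp add: const_def eval_single)

lemma sum_single_keys:
  fixes f :: "'a \<Rightarrow>\<^sub>0 'b::comm_monoid_add"
  shows "(\<Sum>a\<in>Poly_Mapping.keys f. Poly_Mapping.single a (Poly_Mapping.lookup f a)) = f"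
proof (rule poly_mapping_eqI)
  fix k
  show "Poly_Mapping.lookup (\<Sum>a\<in>Poly_Mapping.keys f.
      Poly_Mapping.single a (Poly_Mapping.lookup f a)) k = Poly_Mapping.lookup f k"
    by (simp add: lookup_sum lookup_single when_def in_keys_iff)
qed

lemma eval_mult [simp]: "eval (f * g) x = eval f x * eval g x"
proof -
  have single: "eval (Poly_Mapping.single a c * Poly_Mapping.single b d) x =
      eval (Poly_Mapping.single a c) x * eval (Poly_Mapping.single b d) x" for a b c d
    by (simp add: mult_single eval_single lookup_add power_add prod.distrib mult_ac)
  let ?s = "\<lambda>f. \<Sum>a\<in>Poly_Mapping.keys f. Poly_Mapping.single a (Poly_Mapping.lookup f a)"
  have "eval (?s f * ?s g) x = eval (?s f) x * eval (?s g) x"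
    by (simp only: sum_product eval_sum single)
  then show ?thesis
    by (simp only: sum_single_keys)
qed

lemma eval_scale [simp]: "eval (scale c f) x = c * eval f x"
  by (simp add: scale_def)

lemma eval_diff [simp]:
  fixes f g :: "('v::finite, 'k::field) mpoly"
  shows "eval (f - g) x = eval f x - eval g x"
proof -
  have "eval f x = eval ((f - g) + g) x"
    by simp
  then show ?thesis
    by (simp only: eval_add) simp
qed

text \<open>Lagrange interpolation: for each point \<open>q\<close> of \<open>A\<close> choose a coordinate \<open>v\<close> in which
  \<open>p\<close> and \<open>q\<close> differ and multiply the linear factors \<open>(t\<^sub>v - q\<^sub>v) / (p\<^sub>v - q\<^sub>v)\<close>.\<close>

lemma exists_separating_polynomial:
  fixes p :: "'v::finite \<Rightarrow> 'k::field"
  assumes "finite A" "p \<notin> A"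
  shows "\<exists>g :: ('v, 'k) mpoly. eval g p = 1 \<and> (\<forall>q\<in>A. eval g q = 0)"
  using assms
proof (induction A)
  case empty
  show ?case by (intro exI[of _ "const 1"]) simp
next
  case (insert q A)
  then obtain g :: "('v, 'k) mpoly" where g: "eval g p = 1" "\<forall>q\<in>A. eval g q = 0"
    by auto
  from insert.prems obtain v where v: "p v \<noteq> q v"
    by fastforce
  let ?t = "Poly_Mapping.single (Poly_Mapping.single v 1) 1 :: ('v, 'k) mpoly"
  have t: "eval ?t x = x v" for x
  proof -
    have "eval ?t x = (\<Prod>w\<in>UNIV. if v = w then x w else 1)"
      unfolding eval_single mult_1 by (rule prod.cong) (auto simp: lookup_single)
    then show ?thesis by simp
  qed
  let ?h = "g * scale (1 / (p v - q v)) (?t - const (q v))"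
  have "eval ?h p = 1" "\<forall>q'\<in>insert q A. eval ?h q' = 0"
    using g v by (auto simp: t simp del: One_nat_def)
  then show ?case by blast
qed

section \<open>Degrees and subspaces\<close>

lemma deg_le_iff: "f \<in> deg_le d \<longleftrightarrow> (\<forall>a\<in>Poly_Mapping.keys f. monom_deg a \<le> d)"
  by (simp add: deg_le_def total_deg_def)

lemma deg_le_mono: "d \<le> e \<Longrightarrow> deg_le d \<subseteq> deg_le e"
  by (auto simp: deg_le_def)

lemma keys_scale: "Poly_Mapping.keys (scale c f) \<subseteq> Poly_Mapping.keys f"
  using keys_mult[of "const c" f] by (auto simp: scale_def const_def split: if_splits)

lemma scale_single: "scale c (Poly_Mapping.single a d) = Poly_Mapping.single a (c * d)"
  by (simp add: scale_def const_def mult_single)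

lemma subspace_deg_le: "mpoly.subspace (deg_le d :: ('v::finite, 'k::field) mpoly set)"
proof (rule mpoly.subspaceI)
  fix f g :: "('v, 'k) mpoly" and c
  assume f: "f \<in> deg_le d"
  then show "scale c f \<in> deg_le d"
    using keys_scale by (fastforce simp: deg_le_iff)
  assume "g \<in> deg_le d"
  with f show "f + g \<in> deg_le d"
    using Poly_Mapping.keys_add[of f g] by (fastforce simp: deg_le_iff)
qed (simp add: deg_le_iff)

text \<open>Ideals are the submodules of the ring over itself, so \<open>module.subspace (*)\<close> plays the role
  of the predicate of being an ideal.\<close>

lemma module_times: "module ((*) :: 'a::comm_ring_1 \<Rightarrow> 'a \<Rightarrow> 'a)"
  by unfold_locales (simp_all add: algebra_simps)

lemma ideal_imp_subspace: "module.subspace (*) I \<Longrightarrow> mpoly.subspace I"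
  unfolding module.subspace_def[OF module_times] mpoly.subspace_def
  by (simp add: scale_def)

lemma ideal_vanishing_ideal: "module.subspace (*) (vanishing_ideal X)"
  by (simp add: module.subspace_def[OF module_times] vanishing_ideal_def)

section \<open>Graded monomial orders and standard monomials\<close>

lemma monom_deg_add: "monom_deg (a + b) = monom_deg a + monom_deg b"
  by (simp add: monom_deg_def lookup_add sum.distrib)

lemma graded_monomial_orderD:
  assumes "graded_monomial_order (r :: 'v::finite monom rel)"
  shows graded_refl: "(a, a) \<in> r"
    and graded_total: "(a, b) \<in> r \<or> (b, a) \<in> r"
    and graded_trans: "(a, b) \<in> r \<Longrightarrow> (b, c) \<in> r \<Longrightarrow> (a, c) \<in> r"
    and graded_antisym: "(a, b) \<in> r \<Longrightarrow> (b, a) \<in> r \<Longrightarrow> a = b"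
    and graded_wf: "wf (r - Id)"
    and graded_add: "(a, b) \<in> r \<Longrightarrow> (a + c, b + c) \<in> r"
    and graded_monom_deg: "(a, b) \<in> r \<Longrightarrow> monom_deg a \<le> monom_deg b"
proof -
  have wo: "well_order r" and deg: "\<And>a b. monom_deg a < monom_deg b \<Longrightarrow> (a, b) \<in> r"
    and add: "\<And>a b c. (a, b) \<in> r \<Longrightarrow> (a + c, b + c) \<in> r"
    using assms by (auto simp: graded_monomial_order_def monomial_order_def)
  note ord = wo[unfolded well_order_on_def linear_order_on_def partial_order_on_def preorder_on_def]
  \<comment> \<open>No exponent vector has maximal degree, so gradedness alone puts each of them into the
     field of the order.\<close>
  have "a \<in> Field r" for a
  proof -
    have "monom_deg (Poly_Mapping.single (undefined :: 'v) 1) \<noteq> 0"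
      by (simp add: monom_deg_def lookup_single when_def)
    then have "(a, a + Poly_Mapping.single undefined 1) \<in> r"
      by (intro deg) (simp add: monom_deg_add)
    then show ?thesis by (auto simp: Field_def)
  qed
  then have field: "Field r = UNIV" by auto
  show refl: "(a, a) \<in> r" for a
    using ord field by (auto simp: refl_on_def)
  show "(a, b) \<in> r \<or> (b, a) \<in> r"
    using ord field refl unfolding total_on_def by (metis UNIV_I)
  show "(a, b) \<in> r \<Longrightarrow> (b, c) \<in> r \<Longrightarrow> (a, c) \<in> r"
    using ord by (auto dest: transD)
  show antisym: "(a, b) \<in> r \<Longrightarrow> (b, a) \<in> r \<Longrightarrow> a = b" for a b
    using ord by (auto dest: antisymD)
  show "wf (r - Id)" using ord by auto
  show "(a, b) \<in> r \<Longrightarrow> (a + c, b + c) \<in> r" by (rule add)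
  show "monom_deg a \<le> monom_deg b" if "(a, b) \<in> r"
    using that antisym deg[of b a] by (metis le_less_linear less_irrefl)
qed

lemma lead_monom_greatest:
  fixes r :: "'v::finite monom rel"
  assumes r: "graded_monomial_order r" and "f \<noteq> 0"
  shows "lead_monom r f \<in> Poly_Mapping.keys f"
    and "b \<in> Poly_Mapping.keys f \<Longrightarrow> (b, lead_monom r f) \<in> r"
proof -
  have "\<exists>a\<in>A. \<forall>b\<in>A. (b, a) \<in> r" if "finite A" "A \<noteq> {}" for A
    using that
  proof (induction A rule: finite_ne_induct)
    case (insert x A)
    then show ?case
      using graded_total[OF r] graded_trans[OF r] by (metis insert_iff)
  qed (use graded_refl[OF r] in auto)
  from this[of "Poly_Mapping.keys f"] \<open>f \<noteq> 0\<close>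
  obtain a where a: "a \<in> Poly_Mapping.keys f" "\<forall>b\<in>Poly_Mapping.keys f. (b, a) \<in> r"
    by auto
  then have "lead_monom r f = a"
    unfolding lead_monom_def using graded_antisym[OF r] by (intro the_equality) auto
  with a show "lead_monom r f \<in> Poly_Mapping.keys f"
    and "b \<in> Poly_Mapping.keys f \<Longrightarrow> (b, lead_monom r f) \<in> r"
    by auto
qed

lemma lead_monom_in_initial_ideal:
  assumes "f \<in> I" "f \<noteq> 0"
  shows "Poly_Mapping.single (lead_monom r f) 1 \<in> initial_ideal r I"
  unfolding initial_ideal_def ideal_gen_def
  by (rule module.span_base[OF module_times]) (use assms in blast)

text \<open>Every monomial of a combination \<open>\<Sum> q\<^sub>i in(f\<^sub>i)\<close> is a multiple of one of the \<open>in(f\<^sub>i)\<close>;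
  hence membership of a monomial in the initial ideal is divisibility by a single leading monomial.\<close>

lemma monomial_in_initial_ideal:
  fixes I :: "('v::finite, 'k::field) mpoly set"
  assumes "Poly_Mapping.single a (1::'k) \<in> initial_ideal r I"
  obtains f c where "f \<in> I" "f \<noteq> 0" "a = c + lead_monom r f"
proof -
  let ?M = "{Poly_Mapping.single (lead_monom r f) (1::'k) | f. f \<in> I \<and> f \<noteq> 0}"
  have "\<exists>f c. f \<in> I \<and> f \<noteq> 0 \<and> a = c + lead_monom r f"
    if "p \<in> ideal_gen ?M" "a \<in> Poly_Mapping.keys p" for p a
    using that unfolding ideal_gen_def
  proof (induction arbitrary: a rule: module.span_induct_alt[OF module_times, consumes 1])
    case 1
    then show ?case by simp
  next
    case (2 q x y)
    from 2(1) obtain f where f: "x = Poly_Mapping.single (lead_monom r f) 1" "f \<in> I" "f \<noteq> 0"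
      by auto
    from 2(3) Poly_Mapping.keys_add[of "q * x" y]
    consider "a \<in> Poly_Mapping.keys (q * x)" | "a \<in> Poly_Mapping.keys y" by auto
    then show ?case
    proof cases
      case 1
      with keys_mult[of q x] obtain c where "a = c + lead_monom r f" by (auto simp: f(1))
      with f show ?thesis by blast
    qed (use 2(2) in blast)
  qed
  from this[of "Poly_Mapping.single a 1" a] assms that show thesis
    by (auto simp: initial_ideal_def)
qed

lemma keys_std_span:
  assumes "g \<in> std_span r I" "a \<in> Poly_Mapping.keys g"
  shows "Poly_Mapping.single a 1 \<notin> initial_ideal r I"
  using assms unfolding std_span_def
proof (induction rule: mpoly.span_induct_alt)
  case (step c x y)
  from step.prems Poly_Mapping.keys_add[of "scale c x" y] keys_scale[of c x]
  consider "a \<in> Poly_Mapping.keys x" | "a \<in> Poly_Mapping.keys y" by blast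
  then show ?case
  proof cases
    case 1
    with step.hyps(1) show ?thesis by (auto simp: std_monomials_def)
  qed (rule step.IH)
qed simp

text \<open>The leading monomial of a nonzero element of the ideal lies in the initial ideal, whereas
  only standard monomials occur in an element of the span.\<close>

lemma std_span_Int_ideal:
  assumes r: "graded_monomial_order r" and "g \<in> std_span r I" "g \<in> I"
  shows "g = 0"
proof (rule ccontr)
  assume "g \<noteq> 0"
  with lead_monom_in_initial_ideal[OF \<open>g \<in> I\<close>] keys_std_span[OF \<open>g \<in> std_span r I\<close>]
    lead_monom_greatest(1)[OF r] show False by blast
qed

lemma subspace_std_span: "mpoly.subspace (std_span r I)"
  by (simp add: std_span_def)

text \<open>Together with \<open>std_span_Int_ideal\<close> this says that each residue class has exactly one
  representative in the span of the standard monomials. Reduction replaces a nonstandard monomial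
  by smaller ones, which terminates because the order is a well-order and never raises the degree
  because the order is graded. The degree bound is what links the indicator functions to
  v-numbers and to the Hilbert function.\<close>

lemma reduce_to_std_span:
  fixes I :: "('v::finite, 'k::field) mpoly set"
  assumes r: "graded_monomial_order r" and I: "module.subspace (*) I" and "f \<in> deg_le d"
  shows "\<exists>g\<in>std_span r I \<inter> deg_le d. f - g \<in> I"
proof -
  note subI = ideal_imp_subspace[OF I]
  have subS: "mpoly.subspace (std_span r I \<inter> deg_le d)" for d
    by (intro mpoly.subspace_inter subspace_std_span subspace_deg_le)
  \<comment> \<open>The polynomials that can be reduced form a subspace, so monomials suffice.\<close>
  have combine: "\<exists>g\<in>std_span r I \<inter> deg_le d. f - g \<in> I"
    if "\<And>a. a \<in> Poly_Mapping.keys f \<Longrightarrow>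
      \<exists>g\<in>std_span r I \<inter> deg_le d. Poly_Mapping.single a 1 - g \<in> I" for f d
  proof -
    from that obtain G where G: "\<And>a. a \<in> Poly_Mapping.keys f \<Longrightarrow> G a \<in> std_span r I \<inter> deg_le d"
        "\<And>a. a \<in> Poly_Mapping.keys f \<Longrightarrow> Poly_Mapping.single a 1 - G a \<in> I"
      by metis
    let ?g = "\<Sum>a\<in>Poly_Mapping.keys f. scale (Poly_Mapping.lookup f a) (G a)"
    have "f - ?g = (\<Sum>a\<in>Poly_Mapping.keys f. Poly_Mapping.single a (Poly_Mapping.lookup f a)) - ?g"
      by (simp only: sum_single_keys)
    also have "\<dots> = (\<Sum>a\<in>Poly_Mapping.keys f.
        scale (Poly_Mapping.lookup f a) (Poly_Mapping.single a 1 - G a))"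
      by (simp add: sum_subtractf mpoly.scale_right_diff_distrib scale_single)
    also have "\<dots> \<in> I"
      by (intro mpoly.subspace_sum[OF subI] mpoly.subspace_scale[OF subI] G)
    finally have "f - ?g \<in> I" .
    moreover have "?g \<in> std_span r I \<inter> deg_le d"
      by (intro mpoly.subspace_sum[OF subS] mpoly.subspace_scale[OF subS] G)
    ultimately show ?thesis by blast
  qed
  have monom: "\<exists>g\<in>std_span r I \<inter> deg_le (monom_deg a). Poly_Mapping.single a 1 - g \<in> I" for a
    using graded_wf[OF r]
  proof (induction a rule: wf_induct_rule)
    case (less a)
    show ?case
    proof (cases "Poly_Mapping.single a (1::'k) \<in> initial_ideal r I")
      case False
      then have "Poly_Mapping.single a (1::'k) \<in> std_span r I"
        unfolding std_span_def by (intro mpoly.span_base) (auto simp: std_monomials_def)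
      moreover have "Poly_Mapping.single a (1::'k) \<in> deg_le (monom_deg a)"
        by (simp add: deg_le_iff)
      ultimately show ?thesis
        using mpoly.subspace_0[OF subI] by (intro bexI[of _ "Poly_Mapping.single a 1"]) auto
    next
      case True
      then obtain f c where f: "f \<in> I" "f \<noteq> 0" "a = c + lead_monom r f"
        by (rule monomial_in_initial_ideal)
      let ?l = "lead_monom r f"
      \<comment> \<open>A monic multiple of \<open>f\<close> with leading monomial \<open>a\<close>: subtracting it from \<open>a\<close> leaves only
         smaller monomials.\<close>
      define h where "h = Poly_Mapping.single c (1 / Poly_Mapping.lookup f ?l) * f"
      have "h \<in> I"
        unfolding h_def by (rule module.subspace_scale[OF module_times I f(1)])
      have lead: "Poly_Mapping.lookup f ?l \<noteq> 0"
        using lead_monom_greatest(1)[OF r f(2)] by (simp add: in_keys_iff)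
      have keys_h: "\<exists>b'. b = c + b' \<and> b' \<in> Poly_Mapping.keys f" if "b \<in> Poly_Mapping.keys h" for b
        using that keys_mult[of "Poly_Mapping.single c (1 / Poly_Mapping.lookup f ?l)" f]
        unfolding h_def by (auto split: if_splits)
      have lookup_h: "Poly_Mapping.lookup h a = 1"
      proof -
        have "h = (\<Sum>b\<in>Poly_Mapping.keys f. Poly_Mapping.single (c + b)
            (Poly_Mapping.lookup f b / Poly_Mapping.lookup f ?l))"
          unfolding h_def by (subst (2) sum_single_keys[of f, symmetric])
            (simp add: sum_distrib_left mult_single)
        then have "Poly_Mapping.lookup h a = (\<Sum>b\<in>Poly_Mapping.keys f.
            if b = ?l then Poly_Mapping.lookup f b / Poly_Mapping.lookup f ?l else 0)"
          by (auto simp: lookup_sum lookup_single f(3) when_def intro!: sum.cong)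
        also have "\<dots> = 1"
          using lead lead_monom_greatest(1)[OF r f(2)] by simp
        finally show ?thesis .
      qed
      let ?t = "Poly_Mapping.single a 1 - h"
      have "\<exists>g\<in>std_span r I \<inter> deg_le (monom_deg a). ?t - g \<in> I"
      proof (rule combine)
        fix b assume b: "b \<in> Poly_Mapping.keys ?t"
        then have "b \<noteq> a"
          using lookup_h by (auto simp: in_keys_iff lookup_minus)
        with b have "b \<in> Poly_Mapping.keys h"
          by (auto simp: in_keys_iff lookup_minus lookup_single)
        then have "(b, a) \<in> r"
          using keys_h lead_monom_greatest(2)[OF r f(2)] graded_add[OF r]
          by (metis f(3) add.commute)
        with less[of b] \<open>b \<noteq> a\<close> deg_le_mono[OF graded_monom_deg[OF r, of b a]]
        show "\<exists>g\<in>std_span r I \<inter> deg_le (monom_deg a). Poly_Mapping.single b 1 - g \<in> I"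
          by blast
      qed
      then obtain g where g: "g \<in> std_span r I \<inter> deg_le (monom_deg a)" "?t - g \<in> I" by blast
      have "Poly_Mapping.single a 1 - g = (?t - g) + h" by simp
      then have "Poly_Mapping.single a 1 - g \<in> I"
        using mpoly.subspace_add[OF subI g(2) \<open>h \<in> I\<close>] by simp
      with g(1) show ?thesis by blast
    qed
  qed
  show ?thesis
  proof (rule combine)
    fix a assume "a \<in> Poly_Mapping.keys f"
    with \<open>f \<in> deg_le d\<close> have "monom_deg a \<le> d" by (simp add: deg_le_iff)
    from deg_le_mono[OF this] monom[of a]
    show "\<exists>g\<in>std_span r I \<inter> deg_le d. Poly_Mapping.single a 1 - g \<in> I"
      by blast
  qed
qed

section \<open>Dimension of a quotient\<close>

text \<open>\<open>quot_dim\<close> is a definite description, so its value rests on all bases of the quotient having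
  the same size. Both this and the existence of a basis are transported along the isomorphism
  \<open>U / (U \<inter> ker N) \<cong> N U\<close>: the image of a basis of the quotient is a basis of \<open>N U\<close>, and
  preimages of a basis of \<open>N U\<close> give a basis of the quotient.\<close>

lemma quot_dim_kernel:
  fixes U :: "('v, 'k::field) mpoly set"
  assumes N: "Vector_Spaces.linear scale scale (N :: ('v, 'k) mpoly \<Rightarrow> ('v, 'k) mpoly)"
    and U: "mpoly.subspace U" and F: "finite F" "N ` U \<subseteq> mpoly.span F"
  shows "quot_dim U {u \<in> U. N u = 0} = mpoly.dim (N ` U)"
proof -
  interpret N: Vector_Spaces.linear scale scale N by (rule N)
  let ?W = "{u \<in> U. N u = 0}"
  have lin: "N (\<Sum>b\<in>B. scale (c b) b) = (\<Sum>b\<in>B. scale (c b) (N b))" for B c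
    by (simp add: N.sum N.scale)
  have inU: "(\<Sum>b\<in>B. scale (c b) b) \<in> U" if "B \<subseteq> U" for B c
    using that by (intro mpoly.subspace_sum[OF U] mpoly.subspace_scale[OF U]) auto
  have unique: "card B = mpoly.dim (N ` U)" if B: "quot_basis U ?W B" for B
  proof -
    from B have fin: "finite B" and BU: "B \<subseteq> U"
      and ind: "\<And>c. (\<Sum>b\<in>B. scale (c b) b) \<in> ?W \<Longrightarrow> \<forall>b\<in>B. c b = 0"
      and gen: "\<And>u. u \<in> U \<Longrightarrow> \<exists>c. u - (\<Sum>b\<in>B. scale (c b) b) \<in> ?W"
      unfolding quot_basis_def by blast+
    have "mpoly.independent B"
      by (rule mpoly.independent_if_scalars_zero[OF fin])
        (metis (mono_tags, lifting) ind inU[OF BU] N.zero mem_Collect_eq)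
    moreover have inj: "inj_on N (mpoly.span B)"
    proof (subst N.inj_on_iff_eq_0)
      show "\<forall>x\<in>mpoly.span B. N x = 0 \<longrightarrow> x = 0"
      proof (intro ballI impI)
        fix x assume "x \<in> mpoly.span B" "N x = 0"
        then obtain c where x: "x = (\<Sum>b\<in>B. scale (c b) b)"
          by (auto simp: mpoly.span_finite[OF fin])
        with ind[of c] inU[OF BU, of c] \<open>N x = 0\<close> show "x = 0" by simp
      qed
    qed simp
    ultimately have indep: "mpoly.independent (N ` B)"
      by (rule N.independent_injective_image)
    have "N ` U \<subseteq> mpoly.span (N ` B)"
    proof (rule image_subsetI)
      fix u assume "u \<in> U"
      then obtain c where "N (u - (\<Sum>b\<in>B. scale (c b) b)) = 0"
        using gen by blast
      then have "N u = (\<Sum>b\<in>B. scale (c b) (N b))"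
        by (simp add: N.diff lin)
      then show "N u \<in> mpoly.span (N ` B)"
        by (simp only:) (intro mpoly.span_sum mpoly.span_scale mpoly.span_base imageI)
    qed
    moreover have "card (N ` B) = card B"
      using inj mpoly.span_superset by (intro card_image) (rule inj_on_subset)
    ultimately show ?thesis
      using mpoly.dim_unique[OF _ _ indep refl, of "N ` U"] BU by (simp add: image_mono)
  qed
  have "\<exists>B. quot_basis U ?W B"
  proof -
    obtain C where C: "C \<subseteq> N ` U" "mpoly.independent C" "N ` U \<subseteq> mpoly.span C"
      by (rule mpoly.basis_exists)
    have finC: "finite C"
      using mpoly.independent_span_bound[OF F(1) C(2)] C(1) F(2) by blast
    from C(1) obtain g where g: "\<And>c. c \<in> C \<Longrightarrow> g c \<in> U" "\<And>c. c \<in> C \<Longrightarrow> N (g c) = c"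
      by (metis f_inv_into_f inv_into_into subsetD)
    have inj: "inj_on g C" by (metis g(2) inj_onI)
    have image: "N (\<Sum>b\<in>g ` C. scale (c b) b) = (\<Sum>x\<in>C. scale (c (g x)) x)" for c
      unfolding lin by (simp add: sum.reindex[OF inj] g(2))
    have sub: "g ` C \<subseteq> U" using g(1) by blast
    have "quot_basis U ?W (g ` C)"
      unfolding quot_basis_def
    proof (intro conjI allI impI ballI)
      fix c b assume "(\<Sum>b\<in>g ` C. scale (c b) b) \<in> ?W" "b \<in> g ` C"
      then show "c b = 0"
        using mpoly.independentD[OF C(2) finC order_refl, of "\<lambda>x. c (g x)"] by (auto simp: image)
    next
      fix u assume "u \<in> U"
      then have "N u \<in> mpoly.span C" using C(3) by blast
      then obtain c where "N u = (\<Sum>x\<in>C. scale (c x) x)"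
        by (auto simp: mpoly.span_finite[OF finC])
      then have "N u = N (\<Sum>b\<in>g ` C. scale (c (N b)) b)"
        unfolding image using g(2) by simp
      then have "u - (\<Sum>b\<in>g ` C. scale (c (N b)) b) \<in> ?W"
        using mpoly.subspace_diff[OF U \<open>u \<in> U\<close> inU[OF sub]] by (simp add: N.diff)
      then show "\<exists>c. u - (\<Sum>b\<in>g ` C. scale (c b) b) \<in> ?W" 
        by (intro exI[of _ "\<lambda>b. c (N b)"])
    qed (use finC sub in auto)
    then show ?thesis ..
  qed
  then show ?thesis
    unfolding quot_dim_def using unique by (intro the_equality) blast+
qed

section \<open>Standard indicator functions\<close>

\<comment> \<open>Otherwise index sets \<open>{1..m}\<close> are rewritten to \<open>{Suc 0..m}\<close> and no longer match.\<close>
declare One_nat_def [simp del]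

text \<open>Existence: reduce a separating polynomial to its standard representative, which has the same
  values on the points. Uniqueness: the difference of two solutions vanishes on all the points and
  is a combination of standard monomials.\<close>

lemma ex1_standard_indicator:
  fixes P :: "nat \<Rightarrow> 'v::finite \<Rightarrow> 'k::field"
  assumes r: "graded_monomial_order r" and P: "inj_on P {1..m}" and i: "i \<in> {1..m}"
  shows "\<exists>!g. g \<in> std_span r (vanishing_ideal (P ` {1..m})) \<and> eval g (P i) = 1 \<and>
    (\<forall>j\<in>{1..m}. j \<noteq> i \<longrightarrow> eval g (P j) = 0)"
proof (rule ex_ex1I)
  let ?I = "vanishing_ideal (P ` {1..m})"
  have "P i \<notin> P ` ({1..m} - {i})"
    using P i by (auto dest: inj_onD)
  then obtain h :: "('v, 'k) mpoly"
    where h: "eval h (P i) = 1" "\<forall>q\<in>P ` ({1..m} - {i}). eval h q = 0"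
    using exists_separating_polynomial[of "P ` ({1..m} - {i})" "P i"] by auto
  have "h \<in> deg_le (total_deg h)" by (simp add: deg_le_def)
  then obtain g where g: "g \<in> std_span r ?I" "h - g \<in> ?I"
    using reduce_to_std_span[OF r ideal_vanishing_ideal] by blast
  from g(2) have "eval g (P j) = eval h (P j)" if "j \<in> {1..m}" for j
    using that by (auto simp: vanishing_ideal_def)
  with g(1) h i show "\<exists>g. g \<in> std_span r ?I \<and> eval g (P i) = 1 \<and>
      (\<forall>j\<in>{1..m}. j \<noteq> i \<longrightarrow> eval g (P j) = 0)"
    by (intro exI[of _ g]) auto
next
  let ?I = "vanishing_ideal (P ` {1..m})"
  fix g h
  assume gh: "g \<in> std_span r ?I \<and> eval g (P i) = 1 \<and> (\<forall>j\<in>{1..m}. j \<noteq> i \<longrightarrow> eval g (P j) = 0)"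
    "h \<in> std_span r ?I \<and> eval h (P i) = 1 \<and> (\<forall>j\<in>{1..m}. j \<noteq> i \<longrightarrow> eval h (P j) = 0)"
  have "eval (g - h) (P j) = 0" if "j \<in> {1..m}" for j
    using gh that by (cases "j = i") auto
  then have "g - h \<in> ?I" by (auto simp: vanishing_ideal_def)
  moreover have "g - h \<in> std_span r ?I"
    using gh mpoly.subspace_diff[OF subspace_std_span] by blast
  ultimately show "g = h"
    using std_span_Int_ideal[OF r] by fastforce
qed

text \<open>The locale captures a family of indicator functions of the points \<open>P 1, \<dots>, P m\<close> inside the
  span of the standard monomials, so that the parts of the theorem can be derived separately.\<close>

locale standard_indicators =
  fixes P :: "nat \<Rightarrow> 'v::finite \<Rightarrow> 'k::field" and m :: nat and r :: "'v monom rel"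
    and f :: "nat \<Rightarrow> ('v, 'k) mpoly"
  assumes graded: "graded_monomial_order r"
    and std: "i \<in> {1..m} \<Longrightarrow> f i \<in> std_span r (vanishing_ideal (P ` {1..m}))"
    and eval_f: "i \<in> {1..m} \<Longrightarrow> j \<in> {1..m} \<Longrightarrow> eval (f i) (P j) = (if i = j then 1 else 0)"
begin

abbreviation I where "I \<equiv> vanishing_ideal (P ` {1..m})"

abbreviation Std where "Std \<equiv> std_span r I"

text \<open>The normal form of \<open>g\<close> modulo the vanishing ideal, written through the values of \<open>g\<close>: it is
  the projection of the polynomial ring onto the span of the standard monomials with kernel
  \<open>I\<close>.\<close>

definition interpolant :: "('v, 'k) mpoly \<Rightarrow> ('v, 'k) mpoly" where
  "interpolant g = (\<Sum>i=1..m. scale (eval g (P i)) (f i))"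

lemma linear_interpolant: "Vector_Spaces.linear scale scale interpolant"
  by unfold_locales
    (simp_all add: interpolant_def mpoly.scale_left_distrib sum.distrib mpoly.scale_sum_right)

lemma eval_sum_f: "j \<in> {1..m} \<Longrightarrow> eval (\<Sum>i=1..m. scale (c i) (f i)) (P j) = c j"
proof -
  assume j: "j \<in> {1..m}"
  have "eval (\<Sum>i=1..m. scale (c i) (f i)) (P j) = (\<Sum>i=1..m. if j = i then c i else 0)"
    unfolding eval_sum by (rule sum.cong) (use j in \<open>auto simp: eval_f\<close>)
  then show ?thesis using j by simp
qed

lemma eval_interpolant: "j \<in> {1..m} \<Longrightarrow> eval (interpolant g) (P j) = eval g (P j)"
  unfolding interpolant_def by (rule eval_sum_f)

lemma diff_interpolant: "g - interpolant g \<in> I"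
  by (auto simp: vanishing_ideal_def eval_interpolant)

lemma interpolant_Std: "interpolant g \<in> Std"
  unfolding interpolant_def
  by (intro mpoly.subspace_sum[OF subspace_std_span] mpoly.subspace_scale[OF subspace_std_span] std)

lemma interpolant_eq_0_iff: "interpolant g = 0 \<longleftrightarrow> g \<in> I"
proof
  assume "interpolant g = 0"
  with diff_interpolant[of g] show "g \<in> I" by simp
next
  assume "g \<in> I"
  then show "interpolant g = 0" by (simp add: vanishing_ideal_def interpolant_def)
qed

lemma interpolant_fixes_Std: "g \<in> Std \<Longrightarrow> interpolant g = g"
  using std_span_Int_ideal[OF graded _ diff_interpolant]
    mpoly.subspace_diff[OF subspace_std_span _ interpolant_Std] by fastforce

text \<open>The interpolant depends only on the values of \<open>g\<close> at the points, so it may be computed from a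
  reduction of \<open>g\<close>, whose degree is bounded by that of \<open>g\<close>.\<close>

lemma interpolant_deg_le: "g \<in> deg_le d \<Longrightarrow> interpolant g \<in> deg_le d"
proof -
  assume "g \<in> deg_le d"
  then obtain h where h: "h \<in> Std" "h \<in> deg_le d" "g - h \<in> I"
    using reduce_to_std_span[OF graded ideal_vanishing_ideal] by blast
  from h(3) have "interpolant g = interpolant h"
    unfolding interpolant_def by (intro sum.cong) (auto simp: vanishing_ideal_def)
  with h show ?thesis by (simp add: interpolant_fixes_Std)
qed

lemma interpolant_in_span: "interpolant g \<in> mpoly.span (f ` {1..m})"
  unfolding interpolant_def by (intro mpoly.span_sum mpoly.span_scale mpoly.span_base) auto

lemma inj_on_P: "inj_on P {1..m}"
  by (rule inj_onI) (metis eval_f zero_neq_one)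

lemma inj_on_f: "inj_on f {1..m}"
  by (rule inj_onI) (metis eval_f zero_neq_one)

lemma span_f: "mpoly.span (f ` {1..m}) = Std"
proof
  show "mpoly.span (f ` {1..m}) \<subseteq> Std"
    by (intro mpoly.span_minimal subspace_std_span) (use std in auto)
  show "Std \<subseteq> mpoly.span (f ` {1..m})"
    using interpolant_in_span interpolant_fixes_Std by (metis subsetI)
qed

lemma independent_f: "mpoly.independent (f ` {1..m})"
proof (rule mpoly.independent_if_scalars_zero)
  fix c b assume eq: "(\<Sum>x\<in>f ` {1..m}. scale (c x) x) = 0" and "b \<in> f ` {1..m}"
  then obtain j where "j \<in> {1..m}" "b = f j" by auto
  with eq eval_sum_f[of j "\<lambda>i. c (f i)"] show "c b = 0"
    by (simp add: sum.reindex[OF inj_on_f])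
qed simp

lemma dim_Std: "mpoly.dim Std = m"
  using mpoly.dim_span_eq_card_independent[OF independent_f] card_image[OF inj_on_f]
  by (simp add: span_f)

text \<open>Multiplication by \<open>h\<close> cancels the conditions at the zeros of \<open>h\<close>: \<open>(I : h)\<close> is the vanishing
  ideal of the points where \<open>h\<close> does not vanish. To detect which points these are, test the
  colon ideal with the indicator functions themselves and with the constant \<open>1\<close>.\<close>

lemma colon_eq_point_ideal_iff:
  assumes i: "i \<in> {1..m}"
  shows "colon I h = vanishing_ideal {P i} \<longleftrightarrow>
    eval h (P i) \<noteq> 0 \<and> (\<forall>j\<in>{1..m}. j \<noteq> i \<longrightarrow> eval h (P j) = 0)"
proof
  assume eq: "colon I h = vanishing_ideal {P i}"
  have "eval h (P j) = 0" if j: "j \<in> {1..m}" "j \<noteq> i" for j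
  proof -
    have "f j \<in> colon I h" unfolding eq using i j by (simp add: vanishing_ideal_def eval_f)
    then have "eval (f j * h) (P j) = 0" using j by (simp add: colon_def vanishing_ideal_def)
    then show ?thesis using j by (simp add: eval_f)
  qed
  moreover have "eval h (P i) \<noteq> 0"
  proof
    assume "eval h (P i) = 0"
    with calculation have "1 \<in> colon I h"
      by (fastforce simp: colon_def vanishing_ideal_def)
    moreover have "eval 1 (P i) = (1::'k)"
      using eval_const[of 1 "P i"] by (simp add: const_def)
    ultimately show False unfolding eq by (simp add: vanishing_ideal_def)
  qed
  ultimately show "eval h (P i) \<noteq> 0 \<and> (\<forall>j\<in>{1..m}. j \<noteq> i \<longrightarrow> eval h (P j) = 0)" by blast
next
  assume h: "eval h (P i) \<noteq> 0 \<and> (\<forall>j\<in>{1..m}. j \<noteq> i \<longrightarrow> eval h (P j) = 0)"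
  have "g * h \<in> I \<longleftrightarrow> eval g (P i) = 0" for g
  proof
    show "g * h \<in> I \<Longrightarrow> eval g (P i) = 0"
      using h i by (force simp: vanishing_ideal_def)
    assume g: "eval g (P i) = 0"
    have "eval (g * h) (P j) = 0" if "j \<in> {1..m}" for j
      using that g h by (cases "j = i") auto
    then show "g * h \<in> I" by (auto simp: vanishing_ideal_def)
  qed
  then show "colon I h = vanishing_ideal {P i}"
    by (auto simp: colon_def vanishing_ideal_def)
qed

text \<open>By \<open>colon_eq_point_ideal_iff\<close> the polynomials competing in the v-number are those whose
  interpolant is a nonzero multiple of \<open>f i\<close>, and interpolation does not raise the degree.\<close>

lemma total_deg_f:
  assumes i: "i \<in> {1..m}"
  shows "total_deg (f i) = v_number I (vanishing_ideal {P i})"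
  unfolding v_number_def
proof (rule Least_equality[symmetric])
  have "f i \<noteq> 0" using eval_f[OF i i] by auto
  moreover have "colon I (f i) = vanishing_ideal {P i}"
    using i by (simp add: colon_eq_point_ideal_iff eval_f)
  ultimately show "\<exists>h. h \<noteq> 0 \<and> total_deg h = total_deg (f i) \<and> colon I h = vanishing_ideal {P i}"
    by blast
next
  fix d assume "\<exists>h. h \<noteq> 0 \<and> total_deg h = d \<and> colon I h = vanishing_ideal {P i}"
  then obtain h where h: "h \<in> deg_le d" "eval h (P i) \<noteq> 0"
      "\<forall>j\<in>{1..m}. j \<noteq> i \<longrightarrow> eval h (P j) = 0"
    using i by (auto simp: colon_eq_point_ideal_iff deg_le_def)
  have "interpolant h = (\<Sum>j=1..m. if i = j then scale (eval h (P i)) (f i) else 0)"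
    unfolding interpolant_def by (rule sum.cong) (use h in auto)
  then have "f i = scale (1 / eval h (P i)) (interpolant h)"
    using i h(2) by simp
  then have "f i \<in> deg_le d"
    using mpoly.subspace_scale[OF subspace_deg_le interpolant_deg_le[OF h(1)]] by simp
  then show "total_deg (f i) \<le> d" by (simp add: deg_le_def)
qed

lemma phi_eq: "phi (P ` {1..m}) g = (\<Sum>i=1..m. eval g (P i))"
  by (simp add: phi_def sum.reindex[OF inj_on_P])

text \<open>Since \<open>\<phi> (f i) = 1\<close> for every \<open>i\<close>, an element \<open>\<Sum> c\<^sub>i f\<^sub>i\<close> lies in the kernel exactly when
  \<open>\<Sum> c\<^sub>i = 0\<close>, and then it equals \<open>\<Sum> c\<^sub>i (f\<^sub>i - f\<^sub>m)\<close>, where the term for \<open>m\<close> disappears.\<close>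

lemma ker_phi_Std:
  assumes m: "1 \<le> m"
  shows "mpoly.span ((\<lambda>i. f i - f m) ` {1..m-1}) = ker_phi (P ` {1..m}) \<inter> Std"
proof
  have split: "{1..m} = insert m {1..m-1}" using m by auto
  have "(\<lambda>i. f i - f m) ` {1..m-1} \<subseteq> ker_phi (P ` {1..m}) \<inter> Std"
  proof (rule image_subsetI)
    fix i assume i: "i \<in> {1..m-1}"
    have "(\<Sum>j=1..m. eval (f k) (P j)) = 1" if k: "k \<in> {1..m}" for k
      using k by (simp add: eval_f[OF k] del: atLeastAtMost_iff)
    moreover have "i \<in> {1..m}" "m \<in> {1..m}" using i m by auto
    ultimately have "f i - f m \<in> ker_phi (P ` {1..m})"
      by (simp add: ker_phi_def phi_eq sum_subtractf)
    moreover have "f i - f m \<in> Std"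
      using i m by (intro mpoly.subspace_diff[OF subspace_std_span] std) auto
    ultimately show "f i - f m \<in> ker_phi (P ` {1..m}) \<inter> Std" by blast
  qed
  moreover have "mpoly.subspace (ker_phi (P ` {1..m}))"
    by (simp add: mpoly.subspace_def ker_phi_def phi_eq sum.distrib flip: sum_distrib_left)
  ultimately show "mpoly.span ((\<lambda>i. f i - f m) ` {1..m-1}) \<subseteq> ker_phi (P ` {1..m}) \<inter> Std"
    by (intro mpoly.span_minimal mpoly.subspace_inter subspace_std_span)
  show "ker_phi (P ` {1..m}) \<inter> Std \<subseteq> mpoly.span ((\<lambda>i. f i - f m) ` {1..m-1})"
  proof
    fix g assume g: "g \<in> ker_phi (P ` {1..m}) \<inter> Std"
    then have "g = interpolant g - scale (\<Sum>i=1..m. eval g (P i)) (f m)"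
      by (simp add: ker_phi_def phi_eq interpolant_fixes_Std)
    also have "\<dots> = (\<Sum>i=1..m. scale (eval g (P i)) (f i - f m))"
      unfolding interpolant_def
      by (simp add: mpoly.scale_sum_left sum_subtractf mpoly.scale_right_diff_distrib)
    also have "\<dots> = (\<Sum>i=1..m-1. scale (eval g (P i)) (f i - f m))"
      using m by (subst split) simp
    also have "\<dots> \<in> mpoly.span ((\<lambda>i. f i - f m) ` {1..m-1})"
      by (intro mpoly.span_sum mpoly.span_scale mpoly.span_base) auto
    finally show "g \<in> mpoly.span ((\<lambda>i. f i - f m) ` {1..m-1})" .
  qed
qed

lemma ker_phi_decomposition:
  "ker_phi (P ` {1..m}) = {a + b | a b. a \<in> ker_phi (P ` {1..m}) \<inter> Std \<and> b \<in> I}" (is "?K = ?R")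
proof
  show "?K \<subseteq> ?R"
  proof
    fix g assume "g \<in> ?K"
    then have "interpolant g \<in> ?K \<inter> Std"
      using interpolant_Std by (simp add: ker_phi_def phi_eq eval_interpolant)
    moreover have "g = interpolant g + (g - interpolant g)" by simp
    ultimately show "g \<in> ?R" using diff_interpolant[of g] by blast
  qed
  show "?R \<subseteq> ?K"
    by (auto simp: ker_phi_def phi_eq vanishing_ideal_def)
qed

text \<open>Interpolation identifies \<open>S\<^sub>\<le>\<^sub>d / I\<^sub>\<le>\<^sub>d\<close> with the space of elements of degree at most \<open>d\<close> in the
  \<open>m\<close>-dimensional span of the standard monomials. The Hilbert function therefore attains \<open>m\<close> exactly
  when that space is everything, that is, when it contains the basis \<open>f 1, \<dots>, f m\<close>.\<close>

lemma affine_hilbert_eq_iff: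
  "affine_hilbert I d = m \<longleftrightarrow> (\<forall>i\<in>{1..m}. total_deg (f i) \<le> d)"
proof -
  let ?V = "interpolant ` deg_le d"
  have "I \<inter> deg_le d = {u \<in> deg_le d. interpolant u = 0}"
    by (auto simp: interpolant_eq_0_iff)
  then have hilbert: "affine_hilbert I d = mpoly.dim ?V"
    using quot_dim_kernel[OF linear_interpolant subspace_deg_le, of "f ` {1..m}" d]
      interpolant_in_span by (auto simp: affine_hilbert_def)
  have V: "?V \<subseteq> Std" using interpolant_Std by blast
  show ?thesis
  proof
    assume "affine_hilbert I d = m"
    obtain B where B: "B \<subseteq> ?V" "mpoly.independent B" "card B = mpoly.dim ?V"
      using mpoly.basis_exists by metis
    \<comment> \<open>This basis already has \<open>m\<close> elements, so adjoining some \<open>f i\<close> outside its span would give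
       an independent set larger than a spanning set of \<open>Std\<close>.\<close>
    have "f i \<in> mpoly.span B" if i: "i \<in> {1..m}" for i
    proof (rule ccontr)
      assume "f i \<notin> mpoly.span B"
      then have ins: "mpoly.independent (insert (f i) B)" "f i \<notin> B"
        using mpoly.independent_insertI[OF _ B(2)] mpoly.span_base by auto
      have "insert (f i) B \<subseteq> mpoly.span (f ` {1..m})"
        using B(1) V std[OF i] span_f by auto
      from mpoly.independent_span_bound[OF _ ins(1) this]
      have "finite (insert (f i) B)" "card (insert (f i) B) \<le> m"
        using card_image[OF inj_on_f] by simp_all
      with ins(2) B(3) hilbert \<open>affine_hilbert I d = m\<close> show False by simp
    qed
    moreover have "mpoly.span B \<subseteq> deg_le d"
      by (intro mpoly.span_minimal subspace_deg_le) (use B(1) interpolant_deg_le in blast)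
    ultimately have "f i \<in> deg_le d" if "i \<in> {1..m}" for i
      using that by blast
    then show "\<forall>i\<in>{1..m}. total_deg (f i) \<le> d"
      by (simp add: deg_le_def)
  next
    assume "\<forall>i\<in>{1..m}. total_deg (f i) \<le> d"
    then have "f ` {1..m} \<subseteq> deg_le d" by (auto simp: deg_le_def)
    from mpoly.span_minimal[OF this subspace_deg_le] have deg: "Std \<subseteq> deg_le d"
      by (simp only: span_f)
    have "Std \<subseteq> ?V"
    proof
      fix g assume "g \<in> Std"
      then show "g \<in> ?V"
        using deg interpolant_fixes_Std[of g] by (intro image_eqI[of g _ g]) auto
    qed
    with V have "?V = Std" by (rule subset_antisym)
    then show "affine_hilbert I d = m" by (simp add: hilbert dim_Std)
  qed
qed

lemma hilbert_reg_eq_Max: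
  assumes "1 \<le> m"
  shows "hilbert_reg (P ` {1..m}) = Max ((\<lambda>i. total_deg (f i)) ` {1..m})"
proof -
  have "card (P ` {1..m}) = m" using card_image[OF inj_on_P] by simp
  then have "hilbert_reg (P ` {1..m}) =
      (LEAST l. \<forall>d\<ge>l. \<forall>i\<in>{1..m}. total_deg (f i) \<le> d)"
    by (simp add: hilbert_reg_def affine_hilbert_eq_iff del: atLeastAtMost_iff)
  also have "\<dots> = Max ((\<lambda>i. total_deg (f i)) ` {1..m})"
    using assms by (intro Least_equality) auto
  finally show ?thesis .
qed

end

section \<open>Indicator functions and the kernel of the sum map\<close>

theorem proposition4p6:
  fixes X :: "('v::finite \<Rightarrow> 'k::{field,finite}) set"
    and P :: "nat \<Rightarrow> ('v \<Rightarrow> 'k)"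
    and m :: nat
    and r :: "'v monom rel"
    and I :: "('v, 'k) mpoly set"
  assumes X: "bij_betw P {1..m} X"
    and m: "m \<ge> 2"
    and I: "I = vanishing_ideal X"
    and r: "graded_monomial_order r"
  shows
    "(\<forall>i\<in>{1..m}. \<exists>!g. g \<in> std_span r I \<and> eval g (P i) = 1 \<and>
        (\<forall>j\<in>{1..m}. j \<noteq> i \<longrightarrow> eval g (P j) = 0)) \<and>
     (\<forall>f :: nat \<Rightarrow> ('v, 'k) mpoly.
        (\<forall>i\<in>{1..m}. f i \<in> std_span r I \<and> eval (f i) (P i) = 1 \<and>
           (\<forall>j\<in>{1..m}. j \<noteq> i \<longrightarrow> eval (f i) (P j) = 0)) \<longrightarrow>
        (\<forall>i\<in>{1..m}. total_deg (f i) = v_number I (vanishing_ideal {P i})) \<and>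
        mpoly.independent (f ` {1..m}) \<and> mpoly.span (f ` {1..m}) = std_span r I \<and>
        ker_phi X = {a + b | a b. a \<in> mpoly.span ((\<lambda>i. f i - f m) ` {1..m-1}) \<and> b \<in> I} \<and>
        mpoly.span ((\<lambda>i. f i - f m) ` {1..m-1}) = ker_phi X \<inter> std_span r I \<and>
        ker_phi X \<inter> std_span r I = alg_dual r X (range const) \<and>
        (\<forall>i\<in>{1..m}. total_deg (f i) \<le> hilbert_reg X) \<and>
        (\<exists>j\<in>{1..m}. total_deg (f j) = hilbert_reg X))"
proof (intro conjI allI impI)
  have inj: "inj_on P {1..m}" and X_eq: "X = P ` {1..m}"
    using X by (auto simp: bij_betw_def)
  note I_eq = I[unfolded X_eq]
  show "\<forall>i\<in>{1..m}. \<exists>!g. g \<in> std_span r I \<and> eval g (P i) = 1 \<and>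
      (\<forall>j\<in>{1..m}. j \<noteq> i \<longrightarrow> eval g (P j) = 0)"
    unfolding I_eq by (intro ballI ex1_standard_indicator[OF r inj])
  fix f :: "nat \<Rightarrow> ('v, 'k) mpoly"
  assume f: "\<forall>i\<in>{1..m}. f i \<in> std_span r I \<and> eval (f i) (P i) = 1 \<and>
    (\<forall>j\<in>{1..m}. j \<noteq> i \<longrightarrow> eval (f i) (P j) = 0)"
  interpret standard_indicators P m r f
    by unfold_locales (use r f I_eq in auto)
  have m1: "1 \<le> m" using m by simp
  show "\<forall>i\<in>{1..m}. total_deg (f i) = v_number I (vanishing_ideal {P i})"
    unfolding I_eq by (intro ballI total_deg_f)
  show "mpoly.independent (f ` {1..m})" by (rule independent_f)
  show "mpoly.span (f ` {1..m}) = std_span r I" unfolding I_eq by (rule span_f)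
  show ker: "mpoly.span ((\<lambda>i. f i - f m) ` {1..m-1}) = ker_phi X \<inter> std_span r I"
    unfolding I_eq X_eq by (rule ker_phi_Std[OF m1])
  show "ker_phi X = {a + b | a b. a \<in> mpoly.span ((\<lambda>i. f i - f m) ` {1..m-1}) \<and> b \<in> I}"
    unfolding ker unfolding I_eq X_eq by (rule ker_phi_decomposition)
  show "ker_phi X \<inter> std_span r I = alg_dual r X (range const)"
  proof -
    have "phi X (g * const c) = phi X g * c" for g and c :: 'k
      by (simp add: phi_def sum_distrib_right)
    \<comment> \<open>The constant \<open>1\<close> returns membership in the kernel.\<close>
    then show ?thesis
      by (auto simp: alg_dual_def ker_phi_def I intro: spec[of _ 1])
  qed
  have reg: "hilbert_reg X = Max ((\<lambda>i. total_deg (f i)) ` {1..m})"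
    unfolding X_eq by (rule hilbert_reg_eq_Max[OF m1])
  show "\<forall>i\<in>{1..m}. total_deg (f i) \<le> hilbert_reg X"
    unfolding reg by simp
  have "Max ((\<lambda>i. total_deg (f i)) ` {1..m}) \<in> (\<lambda>i. total_deg (f i)) ` {1..m}"
    using m by (intro Max_in) auto
  then show "\<exists>j\<in>{1..m}. total_deg (f j) = hilbert_reg X"
    unfolding reg by (metis (no_types, lifting) imageE)
qed

end
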